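(* Let $X$ be a nonempty set. For every predicate $P$ on $X$ and all $f\in\mathfrak{UM}(P)$, $T\in\mathfrak{UM}(\mathfrak T)$, $F\in\mathfrak{UM}(\mathfrak F)$, the multifunctions $f_T,f_F\in\mathcal P(X)^X$ defined by $$f_T(x)=T(x)\cap f(x),\qquad f_F(x)=F(x)\cup f(x)\qquad(x\in X)$$ belong to $\mathfrak{UM}(P)$. In addition, for all $x\in X$, $$\bot_{\mathfrak{UM}(P)}(x)=\bot_{\mathfrak{UM}(\mathfrak T)}(x)\cap f(x)=\{x\}\cap f(x),$$ $$\top_{\mathfrak{UM}(P)}(x)=\top_{\mathfrak{UM}(\mathfrak F)}(x)\cup f(x)=(X\setminus\{x\})\cup f(x).$$
   Context: $\mathcal P(X)^X$ is the set of all multifunctions $f:X\to\mathcal P(X)$, where $\mathcal P(X)$ is the power set of $X$. A predicate on $X$ is a function $P:X\to\{0,1\}$ with truth set $P^{-1}(1)=\{x\mid P(x)=1\}$. $\mathfrak T$ is the identically true predicate ($\mathfrak T^{-1}(1)=X$) and $\mathfrak F$ the identically false one ($\mathfrak F^{-1}(1)=\varnothing$). For $f\in\mathcal P(X)^X$, $\mathbf{Fix}(f)=\{x\in X\mid x\in f(x)\}$, and $\mathfrak{UM}(P)=\{f\in\mathcal P(X)^X\mid\mathbf{Fix}(f)=P^{-1}(1)\}$. The set $\mathcal P(X)^X$ is ordered by $g\preccurlyeq f$ iff $g(x)\subset f(x)$ for all $x\in X$, and $\top_{\mathfrak{UM}(P)}$, $\bot_{\mathfrak{UM}(P)}$ denote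 the greatest and least elements of $\mathfrak{UM}(P)$ in this order; explicitly, $\top_{\mathfrak{UM}(P)}(x)=X$ if $P(x)=1$ and $X\setminus\{x\}$ otherwise, $\bot_{\mathfrak{UM}(P)}(x)=\{x\}$ if $P(x)=1$ and $\varnothing$ otherwise. *)

theory Defs
  imports Main "HOL-Library.FuncSet"
begin

text \<open>The set \<open>X\<close> is an explicit carrier. Multifunctions on \<open>X\<close> are extensional (equal to
  \<open>undefined\<close> off \<open>X\<close>), so that HOL equality of multifunctions is equality on \<open>X\<close> and
  greatest and least elements are unique. A predicate is a HOL predicate of which only the
  values on \<open>X\<close> matter.\<close>

definition multifunctions :: "'a set \<Rightarrow> ('a \<Rightarrow> 'a set) set" where
  "multifunctions X = X \<rightarrow>\<^sub>E Pow X"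

definition truth_set :: "'a set \<Rightarrow> ('a \<Rightarrow> bool) \<Rightarrow> 'a set" where
  "truth_set X P = {x \<in> X. P x}"

definition pred_true :: "'a \<Rightarrow> bool" where
  "pred_true = (\<lambda>_. True)"

definition pred_false :: "'a \<Rightarrow> bool" where
  "pred_false = (\<lambda>_. False)"

definition Fix :: "'a set \<Rightarrow> ('a \<Rightarrow> 'a set) \<Rightarrow> 'a set" where
  "Fix X f = {x \<in> X. x \<in> f x}"

definition UM :: "'a set \<Rightarrow> ('a \<Rightarrow> bool) \<Rightarrow> ('a \<Rightarrow> 'a set) set" where
  "UM X P = {f \<in> multifunctions X. Fix X f = truth_set X P}"

definition mf_le :: "'a set \<Rightarrow> ('a \<Rightarrow> 'a set) \<Rightarrow> ('a \<Rightarrow> 'a set) \<Rightarrow> bool" where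
  "mf_le X g f \<longleftrightarrow> (\<forall>x\<in>X. g x \<subseteq> f x)"

definition is_top_UM :: "'a set \<Rightarrow> ('a \<Rightarrow> bool) \<Rightarrow> ('a \<Rightarrow> 'a set) \<Rightarrow> bool" where
  "is_top_UM X P f \<longleftrightarrow> f \<in> UM X P \<and> (\<forall>g \<in> UM X P. mf_le X g f)"

definition is_bot_UM :: "'a set \<Rightarrow> ('a \<Rightarrow> bool) \<Rightarrow> ('a \<Rightarrow> 'a set) \<Rightarrow> bool" where
  "is_bot_UM X P f \<longleftrightarrow> f \<in> UM X P \<and> (\<forall>g \<in> UM X P. mf_le X f g)"

definition top_UM :: "'a set \<Rightarrow> ('a \<Rightarrow> bool) \<Rightarrow> 'a \<Rightarrow> 'a set" where
  "top_UM X P = (THE f. is_top_UM X P f)"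

definition bot_UM :: "'a set \<Rightarrow> ('a \<Rightarrow> bool) \<Rightarrow> 'a \<Rightarrow> 'a set" where
  "bot_UM X P = (THE f. is_bot_UM X P f)"

text \<open>The greatest and least elements exist and are unique, so the descriptions above are
  proper, and they have the expected explicit form.\<close>

lemma mf_le_antisym:
  assumes "f \<in> UM X P" "g \<in> UM X P" "mf_le X f g" "mf_le X g f"
  shows "f = g"
proof (rule extensionalityI[of _ X])
  show "f \<in> extensional X" "g \<in> extensional X"
    using assms by (auto simp: UM_def multifunctions_def PiE_def)
  show "f x = g x" if "x \<in> X" for x
    using assms that by (auto simp: mf_le_def)
qed

lemma is_top_UM_explicit:
  "is_top_UM X P (\<lambda>x\<in>X. if P x then X else X - {x})"
  unfolding is_top_UM_def
proof (intro conjI ballI)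
  show "(\<lambda>x\<in>X. if P x then X else X - {x}) \<in> UM X P"
    by (auto simp: UM_def multifunctions_def Fix_def truth_set_def)
  show "mf_le X g (\<lambda>x\<in>X. if P x then X else X - {x})" if "g \<in> UM X P" for g
    using that by (fastforce simp: UM_def multifunctions_def Fix_def truth_set_def mf_le_def
        PiE_def Pi_def)
qed

lemma is_bot_UM_explicit:
  "is_bot_UM X P (\<lambda>x\<in>X. if P x then {x} else {})"
  by (fastforce simp: is_bot_UM_def UM_def multifunctions_def Fix_def truth_set_def mf_le_def
      split: if_splits)

lemma top_UM_explicit: "top_UM X P = (\<lambda>x\<in>X. if P x then X else X - {x})"
  unfolding top_UM_def
proof (rule the_equality[where P = "is_top_UM X P", OF is_top_UM_explicit])
  show "f = (\<lambda>x\<in>X. if P x then X else X - {x})" if "is_top_UM X P f" for f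
    using that is_top_UM_explicit[of X P] unfolding is_top_UM_def
    by (intro mf_le_antisym) blast+
qed

lemma bot_UM_explicit: "bot_UM X P = (\<lambda>x\<in>X. if P x then {x} else {})"
  unfolding bot_UM_def
proof (rule the_equality[where P = "is_bot_UM X P", OF is_bot_UM_explicit])
  show "f = (\<lambda>x\<in>X. if P x then {x} else {})" if "is_bot_UM X P f" for f
    using that is_bot_UM_explicit[of X P] unfolding is_bot_UM_def
    by (intro mf_le_antisym) blast+
qed

end

theory Submission imports Defs begin

text \<open>A multifunction \<open>f\<close> lies in \<open>UM X P\<close> exactly when, at each point \<open>x\<close> of \<open>X\<close>, membership of
  \<open>x\<close> in \<open>f x\<close> has the truth value \<open>P x\<close>. Pointwise intersection and union of multifunctions
  therefore act on the predicates as conjunction and disjunction, as shown in \<open>UM_Int\<close> and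
  \<open>UM_Un\<close>; and the identically true predicate is neutral for conjunction, the identically false
  one for disjunction.

  The formulas for the extreme elements express the same fact: intersecting \<open>f x\<close> with \<open>{x}\<close>
  forgets everything about \<open>f x\<close> except whether it contains \<open>x\<close>, and so does uniting it
  with \<open>X - {x}\<close>. What is left is determined by \<open>P x\<close> alone.\<close>

lemma UM_iff: "f \<in> UM X P \<longleftrightarrow> f \<in> multifunctions X \<and> (\<forall>x\<in>X. x \<in> f x \<longleftrightarrow> P x)"
  by (auto simp: UM_def Fix_def truth_set_def)

lemma UM_subset: "f \<in> UM X P \<Longrightarrow> x \<in> X \<Longrightarrow> f x \<subseteq> X"
  by (auto simp: UM_def multifunctions_def)

lemma UM_Int:
  assumes "f \<in> UM X P" "g \<in> UM X Q"
  shows "(\<lambda>x\<in>X. f x \<inter> g x) \<in> UM X (\<lambda>x. P x \<and> Q x)"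
  using assms by (auto simp: UM_iff multifunctions_def)

lemma UM_Un:
  assumes "f \<in> UM X P" "g \<in> UM X Q"
  shows "(\<lambda>x\<in>X. f x \<union> g x) \<in> UM X (\<lambda>x. P x \<or> Q x)"
  using assms by (auto simp: UM_iff multifunctions_def)

lemma bot_UM_eq_singleton_Int:
  assumes "f \<in> UM X P" "x \<in> X"
  shows "bot_UM X P x = {x} \<inter> f x"
  using assms by (auto simp: bot_UM_explicit UM_iff)

text \<open>Both values contain all of \<open>X - {x}\<close> and, since \<open>f x \<subseteq> X\<close>, can differ only at \<open>x\<close>.\<close>

lemma top_UM_eq_Diff_Un:
  assumes "f \<in> UM X P" "x \<in> X"
  shows "top_UM X P x = (X - {x}) \<union> f x"
  using assms UM_subset[OF assms] by (auto simp: top_UM_explicit UM_iff)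

theorem corollary3p1:
  fixes X :: "'a set" and P :: "'a \<Rightarrow> bool" and f T F :: "'a \<Rightarrow> 'a set"
  assumes "X \<noteq> {}"
    and "f \<in> UM X P"
    and "T \<in> UM X pred_true"
    and "F \<in> UM X pred_false"
  shows "(\<lambda>x\<in>X. T x \<inter> f x) \<in> UM X P
    \<and> (\<lambda>x\<in>X. F x \<union> f x) \<in> UM X P
    \<and> (\<forall>x\<in>X. bot_UM X P x = bot_UM X pred_true x \<inter> f x
            \<and> bot_UM X pred_true x \<inter> f x = {x} \<inter> f x)
    \<and> (\<forall>x\<in>X. top_UM X P x = top_UM X pred_false x \<union> f x
            \<and> top_UM X pred_false x \<union> f x = (X - {x}) \<union> f x)"
proof (intro conjI ballI)
  show "(\<lambda>x\<in>X. T x \<inter> f x) \<in> UM X P"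
    using UM_Int[OF assms(3,2)] by (simp add: pred_true_def)
  show "(\<lambda>x\<in>X. F x \<union> f x) \<in> UM X P"
    using UM_Un[OF assms(4,2)] by (simp add: pred_false_def)
next
  fix x assume "x \<in> X"
  then have bot_true: "bot_UM X pred_true x = {x}"
    by (simp add: bot_UM_explicit pred_true_def)
  show "bot_UM X P x = bot_UM X pred_true x \<inter> f x"
    unfolding bot_true using assms(2) \<open>x \<in> X\<close> by (rule bot_UM_eq_singleton_Int)
  show "bot_UM X pred_true x \<inter> f x = {x} \<inter> f x"
    by (simp only: bot_true)
next
  fix x assume "x \<in> X"
  then have top_false: "top_UM X pred_false x = X - {x}"
    by (simp add: top_UM_explicit pred_false_def)
  show "top_UM X P x = top_UM X pred_false x \<union> f x"
    unfolding top_false using assms(2) \<open>x \<in> X\<close> by (rule top_UM_eq_Diff_Un)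
  show "top_UM X pred_false x \<union> f x = (X - {x}) \<union> f x"
    by (simp only: top_false)
qed

end
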